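(* Let $P_p,Q_v$ be the position-controllability Gramian and velocity-observability matrix of a second-order system with matrices $M,K\in\mathbb{R}^{n\times n}$, $B_u\in\mathbb{R}^{n\times m}$, $C_p,C_v\in\mathbb{R}^{p\times n}$ and damping $D(s)$, with exact factorizations $P_p=R_pR_p^{\mathsf H}$, $Q_v=L_vL_v^{\mathsf H}$ with $R_p,L_v\in\mathbb{C}^{n\times n}$, and let $\check R_p\in\mathbb{C}^{n\times mJ}$, $\check L_v\in\mathbb{C}^{n\times pK}$ be the quadrature-based factors, all as defined in the context. Assume that the quadrature rules are such that $$\|P_p-\check R_p\check R_p^{\mathsf H}\|_F\leq\frac{\delta}{1+\delta}\,\sigma_{\min}(P_p)\qquad\text{and}\qquad\|Q_v-\check L_v\check L_v^{\mathsf H}\|_F\leq\frac{\delta}{1+\delta}\,\sigma_{\min}(Q_v)$$ for some $\delta\in(0,1)$. Then there exist partial isometries $\Psi_v\in\mathbb{C}^{pK\times n}$ and $\Psi_p\in\mathbb{C}^{mJ\times n}$ such that $$\|\check L_v^{\mathsf H}M\check R_p-\Psi_v(L_v^{\mathsf H}MR_p)\Psi_p^{\mathsf H}\|_F\leq2\delta\,\|L_v\|_2\|M\|_2\|R_p\|_2,$$ $$\|\check L_v^{\mathsf H}K\check R_p-\Psi_v(L_v^{\mathsf H}KR_p)\Psi_p^{\mathsf H}\|_F\leq2\delta\,\|L_v\|_2\|K\|_2\|R_p\|_2,$$ $$\|\check L_v^{\mathsf H}B_u-\Psi_v(L_v^{\mathsf H}B_u)\|_F\leq2\delta\,\|L_v\|_2\|B_u\|_2,$$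 $$\|C_p\check R_p-(C_pR_p)\Psi_p^{\mathsf H}\|_F\leq2\delta\,\|C_p\|_2\|R_p\|_2,$$ $$\|C_v\check R_p-(C_vR_p)\Psi_p^{\mathsf H}\|_F\leq2\delta\,\|C_v\|_2\|R_p\|_2.$$
   Context: Here $\mathrm{i}$ is the imaginary unit, $(\cdot)^{\mathsf H}$ the conjugate transpose, $\|\cdot\|_F$ the Frobenius norm, $\|\cdot\|_2$ the spectral norm, and $\sigma_{\min}(\cdot)$ the smallest singular value. The symbol $K$ denotes the stiffness matrix and, as an index bound, the number of left quadrature nodes. The system has damping $D(s)=f(s)M+g(s)K$ with $f,g:\mathbb{C}\to\mathbb{C}$ (constant $D$ included). Put $\Phi(s)=s^2M+sD(s)+K$. The Gramian-type matrices are $$P_p=\frac1{2\pi}\int_{-\infty}^{\infty}\Phi(\mathrm{i}z)^{-1}B_uB_u^{\mathsf T}\Phi(\mathrm{i}z)^{-\mathsf H}\,\mathrm{d}z,$$ $$Q_v=\frac1{2\pi}\int_{-\infty}^{\infty}\Phi(\mathrm{i}z)^{-\mathsf H}(C_p+\mathrm{i}zC_v)^{\mathsf H}(C_p+\mathrm{i}zC_v)\Phi(\mathrm{i}z)^{-1}\,\mathrm{d}z.$$ It is assumed that these integrals converge and that $P_p$ and $Q_v$ are Hermitian positive definite. (For constant $D$ this holds under the paper's standing assumptions that $M$ is nonsingular, the realization is controllable and observable, and all eigenvalues of $\lambda^2M+\lambda D+K$ lie in the open left half-plane; in that case $P_p,Q_v,R_p,L_v$ can be taken real.) Quadrature-based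 factors: given right nodes $\mathrm{i}\zeta_1,\dots,\mathrm{i}\zeta_J\in\mathrm{i}\mathbb{R}$ with weights $\varrho_j^2$ ($\varrho_j\in\mathbb{R}$) and left nodes $\mathrm{i}\vartheta_1,\dots,\mathrm{i}\vartheta_K\in\mathrm{i}\mathbb{R}$ with weights $\varphi_k^2$ ($\varphi_k\in\mathbb{R}$), at all of which $\Phi$ is invertible, $$\check R_p=\begin{bmatrix}\varrho_1\Phi(\mathrm{i}\zeta_1)^{-1}B_u&\cdots&\varrho_J\Phi(\mathrm{i}\zeta_J)^{-1}B_u\end{bmatrix}\in\mathbb{C}^{n\times mJ},$$ $$\check L_v^{\mathsf H}=\begin{bmatrix}\varphi_1(C_p+\mathrm{i}\vartheta_1C_v)\Phi(\mathrm{i}\vartheta_1)^{-1}\\ \vdots\\ \varphi_K(C_p+\mathrm{i}\vartheta_KC_v)\Phi(\mathrm{i}\vartheta_K)^{-1}\end{bmatrix}\in\mathbb{C}^{pK\times n}.$$ A matrix $\Psi$ is a partial isometry if $\Psi^{\mathsf H}\Psi$ is an orthogonal projection. *)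

theory Defs
  imports "HOL-Analysis.Analysis"
begin

definition cmat :: "real^'n^'m \<Rightarrow> complex^'n^'m" where
  "cmat A = (\<chi> i j. complex_of_real (A $ i $ j))"

definition cscale :: "complex \<Rightarrow> complex^'n^'m \<Rightarrow> complex^'n^'m" where
  "cscale c A = (\<chi> i j. c * A $ i $ j)"

definition ctransp :: "complex^'n^'m \<Rightarrow> complex^'m^'n" where
  "ctransp A = (\<chi> i j. cnj (A $ j $ i))"

definition hermitian_pos_def :: "complex^'n^'n \<Rightarrow> bool" where
  "hermitian_pos_def A \<longleftrightarrow> ctransp A = A \<and>
     (\<forall>x. x \<noteq> 0 \<longrightarrow> 0 < Re (\<Sum>i\<in>UNIV. cnj (x $ i) * (A *v x) $ i))"

definition orthogonal_projection_matrix :: "complex^'n^'n \<Rightarrow> bool" where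
  "orthogonal_projection_matrix A \<longleftrightarrow> A ** A = A \<and> ctransp A = A"

definition partial_isometry :: "complex^'n^'m \<Rightarrow> bool" where
  "partial_isometry A \<longleftrightarrow> orthogonal_projection_matrix (ctransp A ** A)"

text \<open>The library norm on matrices is the Frobenius norm.\<close>

abbreviation frobenius_norm :: "complex^'n^'m \<Rightarrow> real" where
  "frobenius_norm A \<equiv> norm A"

lemma frobenius_norm_eq:
  "frobenius_norm A = sqrt (\<Sum>i\<in>UNIV. \<Sum>j\<in>UNIV. (cmod (A $ i $ j))\<^sup>2)"
  by (simp add: norm_vec_def L2_set_def sum_nonneg)

definition spectral_norm :: "complex^'n^'m \<Rightarrow> real" where
  "spectral_norm A = onorm (\<lambda>x. A *v x)"

text \<open>Only square matrices are needed, so that no convention about which zero singular values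
  of a rectangular matrix are counted is involved.\<close>

definition singular_values :: "complex^'n^'n \<Rightarrow> real set" where
  "singular_values A = {\<sigma>. 0 \<le> \<sigma> \<and>
     (\<exists>v. v \<noteq> 0 \<and> (ctransp A ** A) *v v = complex_of_real (\<sigma>\<^sup>2) *s v)}"

definition sigma_min :: "complex^'n^'n \<Rightarrow> real" where
  "sigma_min A = Min (singular_values A)"

text \<open>Damping is either of the form \<open>f(s) M + g(s) K\<close> or an arbitrary constant real matrix.\<close>

definition admissible_damping ::
  "real^'n^'n \<Rightarrow> real^'n^'n \<Rightarrow> (complex \<Rightarrow> complex^'n^'n) \<Rightarrow> bool" where
  "admissible_damping M K D \<longleftrightarrow>
     (\<exists>f g. \<forall>s. D s = cscale (f s) (cmat M) + cscale (g s) (cmat K)) \<or>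
     (\<exists>D\<^sub>0 :: real^'n^'n. \<forall>s. D s = cmat D\<^sub>0)"

definition Phi ::
  "real^'n^'n \<Rightarrow> (complex \<Rightarrow> complex^'n^'n) \<Rightarrow> real^'n^'n \<Rightarrow> complex \<Rightarrow> complex^'n^'n" where
  "Phi M D K s = cscale (s\<^sup>2) (cmat M) + cscale s (D s) + cmat K"

definition pos_gramian_integrand ::
  "real^'n^'n \<Rightarrow> (complex \<Rightarrow> complex^'n^'n) \<Rightarrow> real^'n^'n \<Rightarrow> real^'m^'n \<Rightarrow> real \<Rightarrow> complex^'n^'n" where
  "pos_gramian_integrand M D K Bu z =
     (let X = matrix_inv (Phi M D K (\<i> * complex_of_real z))
      in X ** cmat Bu ** cmat (transpose Bu) ** ctransp X)"

definition vel_obs_integrand ::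
  "real^'n^'n \<Rightarrow> (complex \<Rightarrow> complex^'n^'n) \<Rightarrow> real^'n^'n \<Rightarrow> real^'n^'p \<Rightarrow> real^'n^'p \<Rightarrow> real
    \<Rightarrow> complex^'n^'n" where
  "vel_obs_integrand M D K Cp Cv z =
     (let X = matrix_inv (Phi M D K (\<i> * complex_of_real z));
          C = cmat Cp + cscale (\<i> * complex_of_real z) (cmat Cv)
      in ctransp X ** ctransp C ** C ** X)"

definition pos_gramian ::
  "real^'n^'n \<Rightarrow> (complex \<Rightarrow> complex^'n^'n) \<Rightarrow> real^'n^'n \<Rightarrow> real^'m^'n \<Rightarrow> complex^'n^'n" where
  "pos_gramian M D K Bu = (1 / (2 * pi)) *\<^sub>R integral UNIV (pos_gramian_integrand M D K Bu)"

definition vel_obs ::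
  "real^'n^'n \<Rightarrow> (complex \<Rightarrow> complex^'n^'n) \<Rightarrow> real^'n^'n \<Rightarrow> real^'n^'p \<Rightarrow> real^'n^'p
    \<Rightarrow> complex^'n^'n" where
  "vel_obs M D K Cp Cv = (1 / (2 * pi)) *\<^sub>R integral UNIV (vel_obs_integrand M D K Cp Cv)"

text \<open>Since \<^const>\<open>matrix_inv\<close> is total, convergence includes the requirement that the integrands
  are defined almost everywhere.\<close>

definition gramians_converge ::
  "real^'n^'n \<Rightarrow> (complex \<Rightarrow> complex^'n^'n) \<Rightarrow> real^'n^'n \<Rightarrow> real^'m^'n \<Rightarrow> real^'n^'p \<Rightarrow> real^'n^'p
    \<Rightarrow> bool" where
  "gramians_converge M D K Bu Cp Cv \<longleftrightarrow>
     negligible {z :: real. \<not> invertible (Phi M D K (\<i> * complex_of_real z))} \<and>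
     pos_gramian_integrand M D K Bu integrable_on UNIV \<and>
     vel_obs_integrand M D K Cp Cv integrable_on UNIV"

text \<open>Column \<open>(j, l)\<close> of the first matrix is column \<open>l\<close> of block \<open>j\<close>; row \<open>(k, l)\<close> of the second
  one is row \<open>l\<close> of block \<open>k\<close>. The index types of the nodes have sizes \<open>J\<close> and \<open>K\<close>.\<close>

definition quad_Rp ::
  "real^'n^'n \<Rightarrow> (complex \<Rightarrow> complex^'n^'n) \<Rightarrow> real^'n^'n \<Rightarrow> real^'m^'n
    \<Rightarrow> ('j::finite \<Rightarrow> real) \<Rightarrow> ('j \<Rightarrow> real) \<Rightarrow> complex^('j \<times> 'm)^'n" where
  "quad_Rp M D K Bu \<zeta> \<rho> = (\<chi> i c. complex_of_real (\<rho> (fst c)) *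
     (matrix_inv (Phi M D K (\<i> * complex_of_real (\<zeta> (fst c)))) ** cmat Bu) $ i $ snd c)"

definition quad_LvH ::
  "real^'n^'n \<Rightarrow> (complex \<Rightarrow> complex^'n^'n) \<Rightarrow> real^'n^'n \<Rightarrow> real^'n^'p \<Rightarrow> real^'n^'p
    \<Rightarrow> ('k::finite \<Rightarrow> real) \<Rightarrow> ('k \<Rightarrow> real) \<Rightarrow> complex^'n^('k \<times> 'p)" where
  "quad_LvH M D K Cp Cv \<theta> \<phi> = (\<chi> r i. complex_of_real (\<phi> (fst r)) *
     ((cmat Cp + cscale (\<i> * complex_of_real (\<theta> (fst r))) (cmat Cv)) **
       matrix_inv (Phi M D K (\<i> * complex_of_real (\<theta> (fst r))))) $ snd r $ i)"

definition quad_Lv ::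
  "real^'n^'n \<Rightarrow> (complex \<Rightarrow> complex^'n^'n) \<Rightarrow> real^'n^'n \<Rightarrow> real^'n^'p \<Rightarrow> real^'n^'p
    \<Rightarrow> ('k::finite \<Rightarrow> real) \<Rightarrow> ('k \<Rightarrow> real) \<Rightarrow> complex^('k \<times> 'p)^'n" where
  "quad_Lv M D K Cp Cv \<theta> \<phi> = ctransp (quad_LvH M D K Cp Cv \<theta> \<phi>)"

end

theory Submission
  imports Defs
begin

text \<open>Since \<open>P = R R\<^sup>H\<close> is positive definite, \<open>R\<close> is invertible and \<open>E = (R\<^sup>-\<^sup>1 R')\<^sup>H\<close> satisfies
  \<open>E\<^sup>H E = 1 + \<Delta>\<close> with \<open>\<parallel>\<Delta>\<parallel>\<^sub>F \<le> \<epsilon> = \<delta> / (1 + \<delta>)\<close>. The polar decomposition of \<open>E\<close> gives a matrix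
  \<open>\<Psi>\<^sub>p\<close> with orthonormal columns and \<open>\<parallel>E - \<Psi>\<^sub>p\<parallel>\<^sub>F \<le> \<epsilon>\<close>, and likewise for \<open>Q\<close>. The two-sided products
  are then perturbed by at most \<open>(2\<epsilon> + \<epsilon>\<^sup>2) \<parallel>L\<parallel>\<^sub>2 \<parallel>M\<parallel>\<^sub>2 \<parallel>R\<parallel>\<^sub>2\<close>, and \<open>2\<epsilon> + \<epsilon>\<^sup>2 \<le> 2\<epsilon> (1 + \<delta>) = 2\<delta>\<close>.\<close>

section \<open>Algebra of the conjugate transpose\<close>

lemma ctransp_ctransp [simp]: "ctransp (ctransp A) = A"
  by (simp add: ctransp_def vec_eq_iff)

lemma ctransp_mult: "ctransp (A ** B) = ctransp B ** ctransp A"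
  by (simp add: ctransp_def matrix_matrix_mult_def vec_eq_iff mult.commute)

lemma ctransp_add: "ctransp (A + B) = ctransp A + ctransp B"
  by (simp add: ctransp_def vec_eq_iff)

lemma ctransp_diff: "ctransp (A - B) = ctransp A - ctransp B"
  by (simp add: ctransp_def vec_eq_iff)

lemma ctransp_scaleR: "ctransp (c *\<^sub>R A) = c *\<^sub>R ctransp A"
  by (simp add: ctransp_def vec_eq_iff complex_eq_iff)

lemma of_real_smult_vec: "complex_of_real c *s v = c *\<^sub>R v"
  by (simp add: vec_eq_iff complex_eq_iff)

lemma ctransp_mat_1 [simp]: "ctransp (mat 1) = mat 1"
  by (auto simp: ctransp_def mat_def vec_eq_iff)

lemma matrix_add_rdistrib:
  fixes A B :: "'a::semiring_1^'n^'m"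
  shows "(A + B) ** C = A ** C + B ** C"
  by (simp add: matrix_matrix_mult_def vec_eq_iff sum.distrib algebra_simps)

lemma matrix_diff_rdistrib:
  fixes A B :: "'a::ring_1^'n^'m"
  shows "(A - B) ** C = A ** C - B ** C"
  by (simp add: matrix_matrix_mult_def vec_eq_iff sum_subtractf algebra_simps)

lemma matrix_diff_ldistrib:
  fixes A :: "'a::ring_1^'n^'m"
  shows "A ** (B - C) = A ** B - A ** C"
  by (simp add: matrix_matrix_mult_def vec_eq_iff sum_subtractf algebra_simps)

lemmas matrix_distribs = matrix_add_ldistrib matrix_add_rdistrib matrix_diff_ldistrib
  matrix_diff_rdistrib

section \<open>Real inner product, Frobenius norm and spectral norm\<close>

lemma inner_complex_vec: "x \<bullet> y = Re (\<Sum>i\<in>UNIV. cnj (x $ i) * y $ i)" for x y :: "complex^'n"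
  by (simp add: inner_vec_def inner_complex_def)

lemma inner_ctransp: "x \<bullet> (A *v y) = (ctransp A *v x) \<bullet> y"
proof -
  have "(\<Sum>i\<in>UNIV. cnj (x $ i) * (A *v y) $ i) = (\<Sum>i\<in>UNIV. \<Sum>j\<in>UNIV. cnj (x $ i) * A $ i $ j * y $ j)"
    by (simp add: matrix_vector_mult_def sum_distrib_left mult.assoc)
  also have "\<dots> = (\<Sum>j\<in>UNIV. \<Sum>i\<in>UNIV. cnj (x $ i) * A $ i $ j * y $ j)"
    by (rule sum.swap)
  also have "\<dots> = (\<Sum>j\<in>UNIV. cnj ((ctransp A *v x) $ j) * y $ j)"
    by (simp add: matrix_vector_mult_def ctransp_def sum_distrib_left sum_distrib_right mult_ac)
  finally show ?thesis
    unfolding inner_complex_vec by simp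
qed

lemma norm_matrix_sq: "(norm A)\<^sup>2 = (\<Sum>i\<in>UNIV. (norm (A $ i))\<^sup>2)"
  for A :: "complex^'n^'m"
  by (simp add: power2_norm_eq_inner inner_vec_def)

lemma norm_transpose_complex: "norm (transpose A) = norm A" for A :: "complex^'n^'m"
proof -
  have "(norm (transpose A))\<^sup>2 = (norm A)\<^sup>2"
    unfolding norm_matrix_sq
    by (simp add: power2_norm_eq_inner inner_vec_def transpose_def) (rule sum.swap)
  then show ?thesis by simp
qed

lemma norm_ctransp [simp]: "norm (ctransp A) = norm A"
proof -
  have "norm (ctransp A) = norm (transpose A)"
    by (simp add: frobenius_norm_eq ctransp_def transpose_def)
  then show ?thesis by (simp add: norm_transpose_complex)
qed

lemma norm_matrix_vector: "norm (A *v x) \<le> spectral_norm A * norm x"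
  unfolding spectral_norm_def by (rule onorm) simp

lemma spectral_norm_le: "(\<And>x. norm (A *v x) \<le> b * norm x) \<Longrightarrow> spectral_norm A \<le> b"
  unfolding spectral_norm_def by (rule onorm_le)

lemma spectral_norm_nonneg [simp]: "0 \<le> spectral_norm A"
  unfolding spectral_norm_def by (rule onorm_pos_le) simp

lemma spectral_norm_mult: "spectral_norm (A ** B) \<le> spectral_norm A * spectral_norm B"
proof (rule spectral_norm_le)
  fix x
  have "norm (A *v (B *v x)) \<le> spectral_norm A * norm (B *v x)"
    by (rule norm_matrix_vector)
  also have "\<dots> \<le> spectral_norm A * (spectral_norm B * norm x)"
    by (intro mult_left_mono norm_matrix_vector) simp
  finally show "norm ((A ** B) *v x) \<le> spectral_norm A * spectral_norm B * norm x"
    by (simp add: matrix_vector_mul_assoc mult.assoc)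
qed

text \<open>With \<open>y = ctransp A *v x\<close>, adjointness turns the square of
  \<open>norm y\<close> into the inner product of \<open>x\<close> with \<open>A *v y\<close>;
  Cauchy-Schwarz and cancelling one factor \<open>norm y\<close> finish. Applied twice, this yields
  equality.\<close>

lemma spectral_norm_ctransp_le: "spectral_norm (ctransp A) \<le> spectral_norm A"
proof (rule spectral_norm_le)
  fix x
  let ?y = "ctransp A *v x"
  have "norm ?y * norm ?y = x \<bullet> (A *v ?y)"
    by (simp add: inner_ctransp norm_eq_square flip: power2_norm_eq_inner power2_eq_square)
  also have "\<dots> \<le> norm x * norm (A *v ?y)"
    by (rule norm_cauchy_schwarz)
  also have "\<dots> \<le> norm x * (spectral_norm A * norm ?y)"
    by (intro mult_left_mono norm_matrix_vector) simp
  finally show "norm ?y \<le> spectral_norm A * norm x"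
    by (cases "?y = 0") (simp_all add: algebra_simps)
qed

lemma spectral_norm_ctransp [simp]: "spectral_norm (ctransp A) = spectral_norm A"
  using spectral_norm_ctransp_le[of A] spectral_norm_ctransp_le[of "ctransp A"] by simp

text \<open>The columns of the product are \<open>A\<close> applied to the columns of
  \<open>B\<close>, and the squared Frobenius norm adds up over columns. The transposes are there
  because indexing a matrix selects its rows.\<close>

lemma norm_mult_spectral_left: "norm (A ** B) \<le> spectral_norm A * norm B"
proof -
  have row: "transpose (A ** B) $ j = A *v (transpose B $ j)" for j
    by (simp add: transpose_def matrix_matrix_mult_def matrix_vector_mult_def vec_eq_iff)
  have "(norm (A ** B))\<^sup>2 = (\<Sum>j\<in>UNIV. (norm (A *v (transpose B $ j)))\<^sup>2)"
    by (simp add: norm_transpose_complex[of "A ** B", symmetric] norm_matrix_sq row)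
  also have "\<dots> \<le> (\<Sum>j\<in>UNIV. (spectral_norm A * norm (transpose B $ j))\<^sup>2)"
    by (intro sum_mono power_mono norm_matrix_vector) simp
  also have "\<dots> = (spectral_norm A * norm (transpose B))\<^sup>2"
    unfolding power_mult_distrib norm_matrix_sq by (simp add: sum_distrib_left)
  finally show ?thesis
    unfolding norm_transpose_complex by (rule power2_le_imp_le) simp
qed

lemma norm_mult_spectral_right: "norm (A ** B) \<le> norm A * spectral_norm B"
  using norm_mult_spectral_left[of "ctransp B" "ctransp A"]
  unfolding ctransp_mult[symmetric] norm_ctransp spectral_norm_ctransp by (simp only: mult.commute)

text \<open>Cauchy-Schwarz for each row of \<open>A\<close>, with the squares then summed over the
  rows.\<close>

lemma spectral_norm_le_norm: "spectral_norm A \<le> norm A"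
proof (rule spectral_norm_le)
  fix x
  have "(norm (A *v x))\<^sup>2 = (\<Sum>i\<in>UNIV. (cmod ((A *v x) $ i))\<^sup>2)"
    by (simp add: power2_norm_eq_inner inner_vec_def)
  also have "\<dots> \<le> (\<Sum>i\<in>UNIV. (norm (A $ i) * norm x)\<^sup>2)"
  proof (intro sum_mono power_mono)
    fix i
    have "cmod ((A *v x) $ i) \<le> (\<Sum>j\<in>UNIV. \<bar>cmod (A $ i $ j)\<bar> * \<bar>cmod (x $ j)\<bar>)"
      unfolding matrix_vector_mult_def by (auto simp: norm_mult intro: order_trans[OF norm_sum])
    also have "\<dots> \<le> norm (A $ i) * norm x"
      unfolding norm_vec_def by (rule L2_set_mult_ineq)
    finally show "cmod ((A *v x) $ i) \<le> norm (A $ i) * norm x" .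
  qed simp
  also have "\<dots> = (norm A * norm x)\<^sup>2"
    unfolding power_mult_distrib norm_matrix_sq by (simp add: sum_distrib_right)
  finally show "norm (A *v x) \<le> norm A * norm x"
    by (rule power2_le_imp_le) simp
qed

lemma norm_matrix_mult: "norm (A ** B) \<le> norm A * norm B" for A :: "complex^'n^'m"
  by (rule order_trans[OF norm_mult_spectral_left])
    (intro mult_right_mono spectral_norm_le_norm norm_ge_zero)

section \<open>Matrices with orthonormal columns and the polar decomposition\<close>

lemma spectral_norm_isometry:
  assumes "ctransp \<Psi> ** \<Psi> = mat 1"
  shows "spectral_norm \<Psi> \<le> 1"
proof (rule spectral_norm_le)
  fix x
  have "(norm (\<Psi> *v x))\<^sup>2 = (norm x)\<^sup>2"
    using assms by (simp add: power2_norm_eq_inner inner_ctransp matrix_vector_mul_assoc)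
  then show "norm (\<Psi> *v x) \<le> 1 * norm x" by simp
qed

text \<open>The square root \<open>1 + T\<close> is obtained from the contraction \<open>T \<mapsto> (\<Delta> - T\<^sup>2) / 2\<close>.\<close>

lemma hermitian_sqrt_near_mat_1:
  fixes \<Delta> :: "complex^'n^'n"
  assumes herm: "ctransp \<Delta> = \<Delta>" and small: "norm \<Delta> \<le> e" "e < 1"
  obtains T where "ctransp T = T" "norm T \<le> e" "(mat 1 + T) ** (mat 1 + T) = mat 1 + \<Delta>"
proof -
  \<comment> \<open>Both conditions in \<open>S\<close> are closed, so \<open>S\<close> is complete;
    the fixed point inherits from them that it is Hermitian and that its norm is at most
    \<open>e\<close>.\<close>
  define S where "S = {T :: complex^'n^'n. ctransp T = T} \<inter> cball 0 e"
  define f where "f T = (1/2) *\<^sub>R (\<Delta> - T ** T)" for T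
  have e0: "0 \<le> e" using order_trans[OF norm_ge_zero small(1)] .
  have "continuous_on UNIV (\<lambda>T :: complex^'n^'n. ctransp T)"
    unfolding ctransp_def by (intro continuous_intros)
  then have "complete S"
    unfolding S_def complete_eq_closed
    by (intro closed_Int closed_cball closed_Collect_eq) auto
  moreover have "0 \<in> S" using e0 by (simp add: S_def ctransp_def vec_eq_iff)
  then have "S \<noteq> {}" by blast
  moreover have "f ` S \<subseteq> S"
  proof (rule image_subsetI)
    fix T assume "T \<in> S"
    then have T: "ctransp T = T" "norm T \<le> e" by (auto simp: S_def)
    have "norm (\<Delta> - T ** T) \<le> norm \<Delta> + norm (T ** T)" by (rule norm_triangle_ineq4)
    also have "\<dots> \<le> e + e * e"
      using T e0 by (intro add_mono small order_trans[OF norm_matrix_mult] mult_mono) auto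
    \<comment> \<open>Here \<open>e < 1\<close> enters; the factor 1/2 in \<open>f\<close> then
      brings the bound back to \<open>e\<close>.\<close>
    also have "\<dots> \<le> 2 * e" using e0 small(2) mult_left_le[of e e] by simp
    finally show "f T \<in> S"
      using T herm by (auto simp: S_def f_def ctransp_scaleR ctransp_diff ctransp_mult)
  qed
  moreover have "dist (f T) (f U) \<le> e * dist T U" if "T \<in> S \<and> U \<in> S" for T U
  proof -
    have TU: "norm T \<le> e" "norm U \<le> e" using that by (auto simp: S_def)
    \<comment> \<open>A difference of squares for matrices that need not commute: the mixed terms
      \<open>T ** U\<close> cancel. Each summand has norm at most \<open>e * norm (T - U)\<close>,
      so the contraction constant is \<open>e\<close>.\<close>
    have "f T - f U = (- 1/2) *\<^sub>R (T ** (T - U) + (T - U) ** U)"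
      by (simp add: f_def matrix_distribs algebra_simps)
    then have "dist (f T) (f U) = 1/2 * norm (T ** (T - U) + (T - U) ** U)"
      by (simp add: dist_norm)
    also have "norm (T ** (T - U) + (T - U) ** U) \<le> e * norm (T - U) + norm (T - U) * e"
      using TU e0 by (intro norm_triangle_mono order_trans[OF norm_matrix_mult] mult_mono) auto
    finally show ?thesis by (simp add: dist_norm)
  qed
  ultimately obtain T where T: "T \<in> S" "f T = T"
    using Banach_fix[of S e f] e0 small(2) by blast
  have "T + T = 2 *\<^sub>R f T" using T(2) by (simp add: scaleR_2)
  then have "T + T = \<Delta> - T ** T" by (simp add: f_def)
  then have "(mat 1 + T) ** (mat 1 + T) = mat 1 + \<Delta>"
    by (simp add: matrix_distribs algebra_simps)
  with T(1) show thesis by (intro that[of T]) (auto simp: S_def)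
qed

text \<open>The polar factor \<open>\<Psi> = E ** V\<close> is used, where \<open>V\<close> inverts
  the square root \<open>mat 1 + T\<close> of \<open>ctransp E ** E\<close>. Then
  \<open>E - \<Psi> = \<Psi> ** T\<close>, and multiplication by \<open>\<Psi>\<close> does not
  increase the Frobenius norm of \<open>T\<close>.\<close>

lemma near_isometry:
  fixes E :: "complex^'n^'m"
  assumes near: "norm (ctransp E ** E - mat 1) \<le> e" "e < 1"
  obtains \<Psi> where "ctransp \<Psi> ** \<Psi> = mat 1" "norm (E - \<Psi>) \<le> e"
proof -
  have "ctransp (ctransp E ** E - mat 1) = ctransp E ** E - mat 1"
    by (simp add: ctransp_diff ctransp_mult)
  then obtain T where T: "ctransp T = T" "norm T \<le> e"
    and sq: "(mat 1 + T) ** (mat 1 + T) = mat 1 + (ctransp E ** E - mat 1)"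
    by (rule hermitian_sqrt_near_mat_1[OF _ near]) 
  \<comment> \<open>A kernel vector satisfies \<open>norm x = norm (T *v x)\<close>, which is at
    most \<open>e * norm x\<close> with \<open>e < 1\<close>.\<close>
  have "x = 0" if "(mat 1 + T) *v x = 0" for x
  proof -
    have "x = - (T *v x)"
      using that by (simp add: matrix_vector_mult_add_rdistrib eq_neg_iff_add_eq_0)
    then have "norm x = norm (T *v x)" by (metis norm_minus_cancel)
    also have "\<dots> \<le> e * norm x"
      using T(2) spectral_norm_le_norm[of T] norm_matrix_vector[of T x]
      by (meson mult_right_mono norm_ge_zero order_trans)
    finally show "x = 0" using near(2) by (simp add: mult_le_cancel_right1)
  qed
  then obtain V where V: "V ** (mat 1 + T) = mat 1"
    using matrix_left_invertible_ker[of "mat 1 + T"] by blast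
  then have V': "(mat 1 + T) ** V = mat 1" by (simp add: matrix_left_right_inverse)
  \<comment> \<open>As \<open>T\<close> is Hermitian, \<open>ctransp V\<close> is also an inverse of
    \<open>mat 1 + T\<close>, so that both square root factors cancel in
    \<open>ctransp \<Psi> ** \<Psi>\<close>.\<close>
  have "ctransp V ** (mat 1 + T) = mat 1"
    using arg_cong[OF V', of ctransp] T(1) by (simp add: ctransp_mult ctransp_add)
  define \<Psi> where "\<Psi> = E ** V"
  have "ctransp \<Psi> ** \<Psi> = ctransp V ** (ctransp E ** E) ** V"
    by (simp add: \<Psi>_def ctransp_mult matrix_mul_assoc)
  also have "ctransp E ** E = (mat 1 + T) ** (mat 1 + T)" using sq by simp
  also have "ctransp V ** \<dots> ** V = (ctransp V ** (mat 1 + T)) ** ((mat 1 + T) ** V)"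
    by (simp add: matrix_mul_assoc)
  finally have iso: "ctransp \<Psi> ** \<Psi> = mat 1"
    using V' \<open>ctransp V ** (mat 1 + T) = mat 1\<close> by simp
  have "\<Psi> ** (mat 1 + T) = E" by (simp add: \<Psi>_def V flip: matrix_mul_assoc)
  then have "E - \<Psi> = \<Psi> ** T" by (auto simp: matrix_distribs)
  then have "norm (E - \<Psi>) \<le> spectral_norm \<Psi> * norm T"
    by (simp add: norm_mult_spectral_left)
  also have "\<dots> \<le> 1 * e"
    using spectral_norm_isometry[OF iso] T(2) by (intro mult_mono) auto
  finally show thesis using iso that by simp
qed

section \<open>The smallest singular value as a bound for the quadratic form\<close>

text \<open>Eigenvectors of the Hermitian matrix \<open>ctransp A ** A\<close> for distinct
  eigenvalues are orthogonal, and an orthogonal family in finite dimension is finite. This is what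
  makes the \<open>Min\<close> in \<open>sigma_min\<close> meaningful.\<close>

lemma finite_singular_values: "finite (singular_values A)"
proof -
  define H where "H = ctransp A ** A"
  have H: "x \<bullet> (H *v y) = (H *v x) \<bullet> y" for x y
    by (simp add: inner_ctransp H_def ctransp_mult)
  have "\<forall>\<sigma>\<in>singular_values A. \<exists>v. v \<noteq> 0 \<and> H *v v = (\<sigma>\<^sup>2) *\<^sub>R v"
    by (auto simp: singular_values_def H_def simp flip: of_real_smult_vec)
  then obtain v where v: "\<And>\<sigma>. \<sigma> \<in> singular_values A \<Longrightarrow> v \<sigma> \<noteq> 0 \<and> H *v v \<sigma> = (\<sigma>\<^sup>2) *\<^sub>R v \<sigma>"
    by metis
  have orth: "v \<sigma> \<bullet> v \<tau> = 0"
    if "\<sigma> \<in> singular_values A" "\<tau> \<in> singular_values A" "\<sigma> \<noteq> \<tau>" for \<sigma> \<tau>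
  proof -
    \<comment> \<open>Squaring is injective here because singular values are nonnegative by
      definition.\<close>
    have "\<sigma>\<^sup>2 \<noteq> \<tau>\<^sup>2" using that by (auto simp: singular_values_def)
    moreover have "\<tau>\<^sup>2 * (v \<sigma> \<bullet> v \<tau>) = \<sigma>\<^sup>2 * (v \<sigma> \<bullet> v \<tau>)"
      using H[of "v \<sigma>" "v \<tau>"] v that by simp
    ultimately show ?thesis by simp
  qed
  have "inj_on v (singular_values A)"
    by (rule inj_onI) (metis inner_eq_zero_iff orth v)
  moreover have "finite (v ` singular_values A)"
    by (rule pairwise_orthogonal_imp_finite) (auto simp: pairwise_def orthogonal_def intro: orth)
  ultimately show ?thesis by (rule finite_imageD[rotated])
qed

text \<open>A minimiser of the quadratic form on the unit sphere is an eigenvector.\<close>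

lemma sigma_min_le_quadratic_form:
  fixes A :: "complex^'n^'n"
  assumes "hermitian_pos_def A"
  obtains l where "0 < l" "sigma_min A \<le> l" "\<And>x. l * (norm x)\<^sup>2 \<le> x \<bullet> (A *v x)"
proof -
  have herm: "ctransp A = A" and pos: "\<And>x. x \<noteq> 0 \<Longrightarrow> 0 < x \<bullet> (A *v x)"
    using assms by (auto simp: hermitian_pos_def_def inner_complex_vec)
  have "continuous_on (sphere 0 1) (\<lambda>x. x \<bullet> (A *v x))"
    by (intro continuous_intros linear_continuous_on) simp
  then obtain v where v: "norm v = 1" "\<And>x. norm x = 1 \<Longrightarrow> v \<bullet> (A *v v) \<le> x \<bullet> (A *v x)"
    using continuous_attains_inf[of "sphere 0 1" "\<lambda>x. x \<bullet> (A *v x)"]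
    by (auto simp: sphere_eq_empty)
  define l where "l = v \<bullet> (A *v v)"
  have "v \<noteq> 0" using v(1) by auto
  have "0 < l" using pos \<open>v \<noteq> 0\<close> by (simp add: l_def)
  have lower: "l * (norm x)\<^sup>2 \<le> x \<bullet> (A *v x)" for x
  proof (cases "x = 0")
    case False
    let ?u = "(1 / norm x) *\<^sub>R x"
    have "l \<le> ?u \<bullet> (A *v ?u)" unfolding l_def using False by (intro v) simp
    also have "\<dots> = (x \<bullet> (A *v x)) / (norm x)\<^sup>2"
      by (simp add: linear_cmul[OF bounded_linear.linear[OF matrix_vector_mul_bounded_linear]]
          power2_eq_square)
    finally show ?thesis using False by (simp add: pos_le_divide_eq)
  qed simp
  \<comment> \<open>The residual of the eigenvalue equation. It is half the gradient at
    \<open>v\<close> of the nonnegative function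
    \<open>x \<bullet> (A *v x) - l * (x \<bullet> x)\<close>, which vanishes at \<open>v\<close>;
    moving along \<open>w\<close> shows that the gradient is zero.\<close>
  define w where "w = A *v v - l *\<^sub>R v"
  have ww: "w \<bullet> w = w \<bullet> (A *v v) - l * (w \<bullet> v)"
    by (subst (2) w_def) (simp add: inner_diff_right)
  define c where "c = w \<bullet> (A *v w) - l * (w \<bullet> w)"
  have nonneg: "0 \<le> 2 * t * (w \<bullet> w) + t\<^sup>2 * c" for t
  proof -
    have sym: "v \<bullet> (A *v w) = w \<bullet> (A *v v)" using inner_ctransp[of v A w] by (simp add: herm inner_commute)
    have "A *v (v + t *\<^sub>R w) = A *v v + t *\<^sub>R (A *v w)"
      by (simp add: matrix_vector_right_distrib linear_cmul[OF bounded_linear.linear])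
    then have "(v + t *\<^sub>R w) \<bullet> (A *v (v + t *\<^sub>R w))
        = l + 2 * t * (w \<bullet> (A *v v)) + t\<^sup>2 * (w \<bullet> (A *v w))"
      by (simp add: inner_add_left inner_add_right sym l_def power2_eq_square algebra_simps)
    moreover have "(norm (v + t *\<^sub>R w))\<^sup>2 = 1 + 2 * t * (w \<bullet> v) + t\<^sup>2 * (w \<bullet> w)"
      using v(1) unfolding power2_norm_eq_inner norm_eq_1
      by (simp add: inner_add_left inner_add_right inner_commute[of v w] power2_eq_square
          algebra_simps)
    ultimately show ?thesis
      using lower[of "v + t *\<^sub>R w"] by (simp only: c_def ww) argo
  qed
  have "w = 0"
  proof (rule ccontr)
    assume "w \<noteq> 0"
    \<comment> \<open>For small negative \<open>t\<close> the linear term dominates. The choice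
      \<open>t = - a / k\<close> is small enough, and the added 1 keeps \<open>k\<close> positive
      when \<open>c = 0\<close>.\<close>
    define a k where "a = w \<bullet> w" and "k = \<bar>c\<bar> + 1"
    have "0 < a" "0 < k" "c / k < 1" using \<open>w \<noteq> 0\<close> by (auto simp: a_def k_def)
    have "2 * (- a / k) * a + (- a / k)\<^sup>2 * c = a\<^sup>2 / k * (c / k - 2)"
      using \<open>0 < k\<close> by (simp add: power2_eq_square field_simps)
    also have "\<dots> < 0"
      using \<open>0 < a\<close> \<open>0 < k\<close> \<open>c / k < 1\<close> by (intro mult_pos_neg divide_pos_pos zero_less_power) linarith+
    finally show False using nonneg[of "- a / k"] by (simp add: a_def)
  qed
  then have Av: "A *v v = of_real l *s v"
    by (simp add: w_def of_real_smult_vec)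
  have "(ctransp A ** A) *v v = of_real (l\<^sup>2) *s v"
    by (simp add: herm Av matrix_vector_mul_assoc[symmetric] vec.scale power2_eq_square)
  then have "l \<in> singular_values A"
    using \<open>0 < l\<close> \<open>v \<noteq> 0\<close> by (auto simp: singular_values_def)
  then have "sigma_min A \<le> l"
    by (simp add: sigma_min_def finite_singular_values)
  with \<open>0 < l\<close> lower show thesis by (intro that)
qed

section \<open>From approximate Gramians to approximate factors\<close>

text \<open>Multiplying the Gramian error by the inverse of \<open>R\<close> on the left and its
  adjoint on the right normalises \<open>P\<close> to the identity. This amplifies the error by at
  most \<open>1 / l\<close> with \<open>sigma_min P \<le> l\<close>, which the factor
  \<open>sigma_min P\<close> in the assumption compensates.\<close>

lemma approximate_factor:
  fixes R :: "complex^'n^'n" and R' :: "complex^'j^'n"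
  assumes pos: "hermitian_pos_def P" and P: "P = R ** ctransp R"
    and approx: "norm (P - R' ** ctransp R') \<le> e * sigma_min P" and e: "0 \<le> e" "e < 1"
  obtains \<Psi> F where "ctransp \<Psi> ** \<Psi> = mat 1" "norm F \<le> e" "R' = R ** ctransp (\<Psi> + F)"
proof -
  obtain l where l: "0 < l" "sigma_min P \<le> l"
    and lower: "\<And>x. l * (norm x)\<^sup>2 \<le> x \<bullet> (P *v x)"
    using sigma_min_le_quadratic_form[OF pos] by blast
  have lower': "l * (norm x)\<^sup>2 \<le> (norm (ctransp R *v x))\<^sup>2" for x
    using lower[of x]
    by (simp add: P inner_ctransp power2_norm_eq_inner flip: matrix_vector_mul_assoc)
  have "x = 0" if "ctransp R *v x = 0" for x
    using lower'[of x] that l(1) by (simp add: mult_le_0_iff)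
  then obtain W where W: "W ** ctransp R = mat 1"
    using matrix_left_invertible_ker[of "ctransp R"] by blast
  define G where "G = ctransp W"
  have RG: "R ** G = mat 1"
    using arg_cong[OF W, of ctransp] by (simp add: ctransp_mult G_def)
  have GR: "G ** R = mat 1" using RG by (simp add: matrix_left_right_inverse)
  have RW: "ctransp R ** W = mat 1" using W by (simp add: matrix_left_right_inverse)
  \<comment> \<open>\<open>W\<close> inverts \<open>ctransp R\<close>, so the lower bound
    \<open>lower'\<close> becomes an upper bound for \<open>W\<close>.\<close>
  have "spectral_norm W \<le> 1 / sqrt l"
  proof (rule spectral_norm_le)
    fix x
    have "l * (norm (W *v x))\<^sup>2 \<le> (norm x)\<^sup>2"
      using lower'[of "W *v x"] by (simp add: matrix_vector_mul_assoc RW)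
    then have "(sqrt l * norm (W *v x))\<^sup>2 \<le> (norm x)\<^sup>2"
      using l(1) by (simp add: power_mult_distrib)
    then have "sqrt l * norm (W *v x) \<le> norm x" by (rule power2_le_imp_le) simp
    then show "norm (W *v x) \<le> 1 / sqrt l * norm x"
      using l(1) by (simp add: pos_le_divide_eq mult.commute)
  qed
  then have sW: "spectral_norm W * spectral_norm W \<le> 1 / l"
    using mult_mono[of "spectral_norm W" "1 / sqrt l" "spectral_norm W" "1 / sqrt l"] l(1)
    by simp
  let ?Y = "R' ** ctransp R' - P"
  define E where "E = ctransp (G ** R')"
  \<comment> \<open>By the definition of \<open>E\<close>, the product \<open>ctransp E ** E\<close>
    is \<open>G ** R' ** ctransp R' ** W\<close>, and \<open>G ** P ** W\<close> is the
    identity.\<close>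
  have "ctransp E ** E - mat 1 = G ** ?Y ** W"
  proof -
    have "G ** P ** W = mat 1"
      using GR RW by (simp add: P matrix_mul_assoc) 
    then show ?thesis
      by (simp add: E_def ctransp_mult G_def matrix_distribs matrix_mul_assoc)
  qed
  then have "norm (ctransp E ** E - mat 1) \<le> spectral_norm W * norm ?Y * spectral_norm W"
    by (simp add: G_def order_trans[OF norm_mult_spectral_right]
        mult_right_mono[OF order_trans[OF norm_mult_spectral_left]])
  also have "\<dots> = spectral_norm W * spectral_norm W * norm ?Y" by simp
  also have "\<dots> \<le> 1 / l * (e * l)"
    using approx l e mult_left_mono[OF l(2) e(1)]
    by (intro mult_mono sW) (auto simp: norm_minus_commute)
  also have "\<dots> = e" using l by simp
  finally obtain \<Psi> where \<Psi>: "ctransp \<Psi> ** \<Psi> = mat 1" "norm (E - \<Psi>) \<le> e"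
    using near_isometry[OF _ e(2)] by blast
  \<comment> \<open>The perturbation \<open>F\<close> is the distance of \<open>E\<close> from its
    polar factor; \<open>R ** G = mat 1\<close> recovers \<open>R'\<close> exactly.\<close>
  have "R' = R ** ctransp (\<Psi> + (E - \<Psi>))"
    by (simp add: E_def matrix_mul_assoc RG)
  with \<Psi> show thesis by (rule that)
qed

section \<open>Perturbation of matrix products and the final estimates\<close>

lemma partial_isometry_of_isometry: "ctransp \<Psi> ** \<Psi> = mat 1 \<Longrightarrow> partial_isometry \<Psi>"
  by (simp add: partial_isometry_def orthogonal_projection_matrix_def)

lemma norm_left_perturbation:
  assumes "norm F \<le> e"
  shows "norm ((\<Psi> + F) ** N - \<Psi> ** N) \<le> e * spectral_norm N"
proof -
  have "(\<Psi> + F) ** N - \<Psi> ** N = F ** N" by (simp add: matrix_distribs)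
  then show ?thesis
    using order_trans[OF norm_mult_spectral_right mult_right_mono[OF assms]] by simp
qed

lemma norm_right_perturbation:
  assumes "norm F \<le> e"
  shows "norm (N ** ctransp (\<Psi> + F) - N ** ctransp \<Psi>) \<le> e * spectral_norm N"
  using norm_left_perturbation[OF assms, of \<Psi> "ctransp N"]
    norm_ctransp[of "N ** ctransp (\<Psi> + F) - N ** ctransp \<Psi>"]
  by (simp add: ctransp_mult ctransp_diff)

text \<open>The factors are replaced one at a time. Replacing the right one while the left is still
  perturbed costs \<open>e * (1 + e)\<close>, replacing the left one afterwards costs
  \<open>e\<close>; the sum is \<open>e * (2 + e)\<close>.\<close>

lemma norm_two_sided_perturbation:
  assumes F: "norm F \<le> e" and G: "norm G \<le> e"
    and \<Psi>: "spectral_norm \<Psi> \<le> 1" and \<Omega>: "spectral_norm \<Omega> \<le> 1"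
  shows "norm ((\<Psi> + F) ** N ** ctransp (\<Omega> + G) - \<Psi> ** N ** ctransp \<Omega>)
    \<le> e * (2 + e) * spectral_norm N"
proof -
  have e: "0 \<le> e" using order_trans[OF norm_ge_zero F] .
  have "spectral_norm ((\<Psi> + F) ** N) \<le> (1 + e) * spectral_norm N"
  proof (rule order_trans[OF spectral_norm_mult], rule mult_right_mono)
    have "spectral_norm (\<Psi> + F) \<le> spectral_norm \<Psi> + spectral_norm F"
      unfolding spectral_norm_def matrix_vector_mult_add_rdistrib by (rule onorm_triangle) simp_all
    then show "spectral_norm (\<Psi> + F) \<le> 1 + e"
      using \<Psi> F spectral_norm_le_norm[of F] by linarith
  qed simp
  then have right: "norm ((\<Psi> + F) ** N ** ctransp (\<Omega> + G) - (\<Psi> + F) ** N ** ctransp \<Omega>)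
      \<le> e * ((1 + e) * spectral_norm N)"
    by (rule order_trans[OF norm_right_perturbation[OF G] mult_left_mono[OF _ e]])
  have "norm (((\<Psi> + F) ** N - \<Psi> ** N) ** ctransp \<Omega>)
      \<le> norm ((\<Psi> + F) ** N - \<Psi> ** N) * spectral_norm \<Omega>"
    using norm_mult_spectral_right[of _ "ctransp \<Omega>"] by simp
  also have "\<dots> \<le> e * spectral_norm N * 1"
    using e by (intro mult_mono[OF norm_left_perturbation[OF F] \<Omega>]) auto
  finally have left: "norm ((\<Psi> + F) ** N ** ctransp \<Omega> - \<Psi> ** N ** ctransp \<Omega>) \<le> e * spectral_norm N"
    by (simp add: matrix_distribs)
  show ?thesis
    using norm_triangle_ineq[of "(\<Psi> + F) ** N ** ctransp (\<Omega> + G) - (\<Psi> + F) ** N ** ctransp \<Omega>"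
        "(\<Psi> + F) ** N ** ctransp \<Omega> - \<Psi> ** N ** ctransp \<Omega>"] left right
    by (simp add: algebra_simps)
qed

theorem theorem4:
  fixes M K :: "real^'n^'n" and D :: "complex \<Rightarrow> complex^'n^'n"
    and Bu :: "real^'m^'n" and Cp Cv :: "real^'n^'p"
    and \<zeta> \<rho> :: "'j::finite \<Rightarrow> real" and \<theta> \<phi> :: "'k::finite \<Rightarrow> real"
    and P Q R L :: "complex^'n^'n"
    and R' :: "complex^('j \<times> 'm)^'n" and L' :: "complex^('k \<times> 'p)^'n"
    and \<delta> :: real
  assumes damping: "admissible_damping M K D"
    and conv: "gramians_converge M D K Bu Cp Cv"
    and P: "P = pos_gramian M D K Bu" and Q: "Q = vel_obs M D K Cp Cv"
    and P_pos: "hermitian_pos_def P" and Q_pos: "hermitian_pos_def Q"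
    and P_factor: "P = R ** ctransp R" and Q_factor: "Q = L ** ctransp L"
    and right_nodes: "\<forall>j. invertible (Phi M D K (\<i> * complex_of_real (\<zeta> j)))"
    and left_nodes: "\<forall>k. invertible (Phi M D K (\<i> * complex_of_real (\<theta> k)))"
    and R': "R' = quad_Rp M D K Bu \<zeta> \<rho>" and L': "L' = quad_Lv M D K Cp Cv \<theta> \<phi>"
    and delta: "0 < \<delta>" "\<delta> < 1"
    and quad_P: "frobenius_norm (P - R' ** ctransp R') \<le> \<delta> / (1 + \<delta>) * sigma_min P"
    and quad_Q: "frobenius_norm (Q - L' ** ctransp L') \<le> \<delta> / (1 + \<delta>) * sigma_min Q"
  shows "\<exists>(\<Psi>v :: complex^'n^('k \<times> 'p)) (\<Psi>p :: complex^'n^('j \<times> 'm)).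
    partial_isometry \<Psi>v \<and> partial_isometry \<Psi>p \<and>
    frobenius_norm (ctransp L' ** cmat M ** R' - \<Psi>v ** (ctransp L ** cmat M ** R) ** ctransp \<Psi>p)
      \<le> 2 * \<delta> * spectral_norm L * spectral_norm (cmat M) * spectral_norm R \<and>
    frobenius_norm (ctransp L' ** cmat K ** R' - \<Psi>v ** (ctransp L ** cmat K ** R) ** ctransp \<Psi>p)
      \<le> 2 * \<delta> * spectral_norm L * spectral_norm (cmat K) * spectral_norm R \<and>
    frobenius_norm (ctransp L' ** cmat Bu - \<Psi>v ** (ctransp L ** cmat Bu))
      \<le> 2 * \<delta> * spectral_norm L * spectral_norm (cmat Bu) \<and>
    frobenius_norm (cmat Cp ** R' - (cmat Cp ** R) ** ctransp \<Psi>p)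
      \<le> 2 * \<delta> * spectral_norm (cmat Cp) * spectral_norm R \<and>
    frobenius_norm (cmat Cv ** R' - (cmat Cv ** R) ** ctransp \<Psi>p)
      \<le> 2 * \<delta> * spectral_norm (cmat Cv) * spectral_norm R"
proof -
  define e where "e = \<delta> / (1 + \<delta>)"
  have e: "0 \<le> e" "e < 1" "e \<le> \<delta>" using delta by (auto simp: e_def field_simps)
  have e2: "e * (2 + e) \<le> 2 * \<delta>"
  proof -
    have "e * (2 + e) \<le> e * (2 + 2 * \<delta>)" using e delta by (intro mult_left_mono) auto
    also have "\<dots> = 2 * \<delta>" using delta by (simp add: e_def field_simps)
    finally show ?thesis .
  qed
  obtain \<Psi>p F where \<Psi>p: "ctransp \<Psi>p ** \<Psi>p = mat 1" and F: "norm F \<le> e"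
    and R'_eq: "R' = R ** ctransp (\<Psi>p + F)"
    using approximate_factor[OF P_pos P_factor quad_P[folded e_def] e(1,2)] by blast
  obtain \<Psi>v G where \<Psi>v: "ctransp \<Psi>v ** \<Psi>v = mat 1" and G: "norm G \<le> e"
    and L'_eq: "L' = L ** ctransp (\<Psi>v + G)"
    using approximate_factor[OF Q_pos Q_factor quad_Q[folded e_def] e(1,2)] by blast
  have L'_H: "ctransp L' = (\<Psi>v + G) ** ctransp L"
    by (simp add: L'_eq ctransp_mult)
  have two: "norm (ctransp L' ** N ** R' - \<Psi>v ** (ctransp L ** N ** R) ** ctransp \<Psi>p)
      \<le> 2 * \<delta> * spectral_norm L * spectral_norm N * spectral_norm R" for N
  proof -
    have "norm (ctransp L' ** N ** R' - \<Psi>v ** (ctransp L ** N ** R) ** ctransp \<Psi>p)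
        \<le> e * (2 + e) * spectral_norm (ctransp L ** N ** R)"
      using norm_two_sided_perturbation[OF G F spectral_norm_isometry[OF \<Psi>v]
          spectral_norm_isometry[OF \<Psi>p], of "ctransp L ** N ** R"]
      by (simp add: L'_H R'_eq matrix_mul_assoc)
    also have "\<dots> \<le> 2 * \<delta> * (spectral_norm L * spectral_norm N * spectral_norm R)"
    proof (rule mult_mono[OF e2])
      have "spectral_norm (ctransp L ** N) * spectral_norm R
          \<le> spectral_norm L * spectral_norm N * spectral_norm R"
        using spectral_norm_mult[of "ctransp L" N] by (intro mult_right_mono) auto
      then show "spectral_norm (ctransp L ** N ** R)
          \<le> spectral_norm L * spectral_norm N * spectral_norm R"
        by (rule order_trans[OF spectral_norm_mult])
    qed (use delta in auto)
    finally show ?thesis by (simp add: mult.assoc)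
  qed
  have left: "norm (ctransp L' ** N - \<Psi>v ** (ctransp L ** N))
      \<le> 2 * \<delta> * spectral_norm L * spectral_norm N" for N :: "complex^'m^'n"
  proof -
    have "norm (ctransp L' ** N - \<Psi>v ** (ctransp L ** N)) \<le> e * spectral_norm (ctransp L ** N)"
      using norm_left_perturbation[OF G, of \<Psi>v "ctransp L ** N"]
      by (simp add: L'_H matrix_mul_assoc)
    \<comment> \<open>With only one perturbed factor the loss is \<open>e \<le> \<delta>\<close>, so
      the factor 2 leaves room.\<close>
    also have "\<dots> \<le> (2 * \<delta>) * (spectral_norm L * spectral_norm N)"
      using e delta spectral_norm_mult[of "ctransp L" N] by (intro mult_mono) auto
    finally show ?thesis by (simp add: mult.assoc)
  qed
  have right: "norm (N ** R' - N ** R ** ctransp \<Psi>p)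
      \<le> 2 * \<delta> * spectral_norm N * spectral_norm R" for N :: "complex^'n^'p"
  proof -
    have "norm (N ** R' - N ** R ** ctransp \<Psi>p) \<le> e * spectral_norm (N ** R)"
      using norm_right_perturbation[OF F, of "N ** R" \<Psi>p]
      by (simp add: R'_eq matrix_mul_assoc)
    also have "\<dots> \<le> (2 * \<delta>) * (spectral_norm N * spectral_norm R)"
      using e delta by (intro mult_mono spectral_norm_mult) auto
    finally show ?thesis by (simp add: mult.assoc)
  qed
  show ?thesis
    using partial_isometry_of_isometry[OF \<Psi>v] partial_isometry_of_isometry[OF \<Psi>p]
      two left right by blast
qed

end
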